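(* For an instance with cardinality-based rates $(N,d,(r_1,\dots,r_N))$, the schedule $\mathcal H^1=\{\{1\},\dots,\{N\}\}$, in which each singleton group $\{i\}$ is activated for duration $d_i/r_1$, is optimal if and only if $$m\,r_m\le r_1\qquad\text{for all } m=2,\dots,N .$$
   Context: $\mathcal N=\{1,\dots,N\}$ is a set of links with strictly positive demands $d_1,\dots,d_N$. $\mathcal H$ is the set of all nonempty subsets of $\mathcal N$, called groups. Cardinality-based rates: there are numbers $r_1\ge r_2\ge\dots\ge r_N\ge 0$ with $r_1>0$ such that, when group $\mathcal c$ is active, every link $i\in \mathcal c$ is served at rate $r_{|\mathcal c|}$ and links outside $\mathcal c$ at rate $0$. A schedule is a vector $T=(T_{\mathcal c})_{\mathcal c\in\mathcal H}\ge 0$ with $\sum_{\mathcal c\ni i}r_{|\mathcal c|}T_{\mathcal c}=d_i$ for every $i$; its length is $\sum_{\mathcal c}T_{\mathcal c}$; it is optimal if its length is minimum. *)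

theory Defs
  imports Complex_Main
begin

definition links :: "nat \<Rightarrow> nat set" where
  "links N = {1..N}"

definition groups :: "nat \<Rightarrow> nat set set" where
  "groups N = {c. c \<subseteq> links N \<and> c \<noteq> {}}"

text \<open>Only the values \<open>r 1, \<dots>, r N\<close> and \<open>d 1, \<dots>, d N\<close> matter; \<open>r\<close> is indexed by group size.\<close>

definition valid_instance :: "nat \<Rightarrow> (nat \<Rightarrow> real) \<Rightarrow> (nat \<Rightarrow> real) \<Rightarrow> bool" where
  "valid_instance N d r \<longleftrightarrow>
     1 \<le> N \<and> (\<forall>i\<in>links N. 0 < d i) \<and>
     antimono_on {1..N} r \<and> 0 \<le> r N \<and> 0 < r 1"

definition rate :: "(nat \<Rightarrow> real) \<Rightarrow> nat set \<Rightarrow> nat \<Rightarrow> real" where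
  "rate r c i = (if i \<in> c then r (card c) else 0)"

text \<open>A schedule is a function on all sets of naturals, of which only the values on
  \<open>groups N\<close> are ever used.\<close>

definition is_schedule ::
  "nat \<Rightarrow> (nat \<Rightarrow> real) \<Rightarrow> (nat \<Rightarrow> real) \<Rightarrow> (nat set \<Rightarrow> real) \<Rightarrow> bool" where
  "is_schedule N d r T \<longleftrightarrow>
     (\<forall>c\<in>groups N. 0 \<le> T c) \<and>
     (\<forall>i\<in>links N. (\<Sum>c\<in>groups N. rate r c i * T c) = d i)"

definition schedule_length :: "nat \<Rightarrow> (nat set \<Rightarrow> real) \<Rightarrow> real" where
  "schedule_length N T = (\<Sum>c\<in>groups N. T c)"

definition optimal_schedule ::
  "nat \<Rightarrow> (nat \<Rightarrow> real) \<Rightarrow> (nat \<Rightarrow> real) \<Rightarrow> (nat set \<Rightarrow> real) \<Rightarrow> bool" where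
  "optimal_schedule N d r T \<longleftrightarrow>
     is_schedule N d r T \<and>
     (\<forall>T'. is_schedule N d r T' \<longrightarrow> schedule_length N T \<le> schedule_length N T')"

definition singleton_schedule ::
  "(nat \<Rightarrow> real) \<Rightarrow> (nat \<Rightarrow> real) \<Rightarrow> nat set \<Rightarrow> real" where
  "singleton_schedule d r c = (if is_singleton c then d (the_elem c) / r 1 else 0)"

end

theory Submission
  imports Defs
begin

text \<open>Summing the demand equations over the links shows that every schedule satisfies
  \<open>\<Sum>i. d i = \<Sum>c. |c| r\<^bsub>|c|\<^esub> T c\<close>, so if \<open>m r\<^sub>m \<le> r\<^sub>1\<close> for all \<open>m\<close>, no schedule is shorter than
  \<open>(\<Sum>i. d i) / r\<^sub>1\<close>, the length of the singleton schedule. If instead \<open>m r\<^sub>m > r\<^sub>1\<close>, activating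
  \<open>{1..m}\<close> for a short time \<open>e\<close> and serving the remaining demands by singletons changes the length
  by \<open>e (1 - m r\<^sub>m / r\<^sub>1) < 0\<close>.\<close>

lemma finite_links [simp]: "finite (links N)"
  by (simp add: links_def)

lemma finite_groups [simp]: "finite (groups N)"
  by (simp add: groups_def)

text \<open>The map \<open>\<lambda>i. {i}\<close> is a bijection from the links onto the singleton
  groups, so a sum over exponentially many groups collapses to one over the links.\<close>

lemma sum_groups_singletons:
  assumes "\<And>c. c \<in> groups N \<Longrightarrow> \<not> is_singleton c \<Longrightarrow> f c = 0"
  shows "(\<Sum>c\<in>groups N. f c) = (\<Sum>i\<in>links N. f {i})"
proof -
  have "(\<Sum>c\<in>groups N. f c) = sum f ((\<lambda>i. {i}) ` links N)"
    using assms by (intro sum.mono_neutral_right) (auto simp: groups_def is_singleton_def)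
  also have "\<dots> = (\<Sum>i\<in>links N. f {i})"
    by (subst sum.reindex) (auto simp: inj_on_def)
  finally show ?thesis .
qed

lemma schedule_length_singleton_schedule:
  "schedule_length N (singleton_schedule d r) = (\<Sum>i\<in>links N. d i) / r 1"
  unfolding schedule_length_def
  by (subst sum_groups_singletons) (auto simp: singleton_schedule_def sum_divide_distrib)

lemma service_singleton_schedule:
  assumes "r 1 \<noteq> 0" "i \<in> links N"
  shows "(\<Sum>c\<in>groups N. rate r c i * singleton_schedule d r c) = d i"
proof -
  have "(\<Sum>c\<in>groups N. rate r c i * singleton_schedule d r c) =
      (\<Sum>j\<in>links N. rate r {j} i * singleton_schedule d r {j})"
    by (rule sum_groups_singletons) (simp add: singleton_schedule_def)
  also have "\<dots> = (\<Sum>j\<in>links N. if i = j then d j else 0)"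
    using assms by (intro sum.cong) (auto simp: rate_def singleton_schedule_def)
  also have "\<dots> = d i"
    using assms by simp
  finally show ?thesis .
qed

text \<open>Zero demands are allowed because this is also applied to residual demands, which may
  vanish.\<close>

lemma singleton_schedule_nonneg:
  assumes "0 \<le> r 1" "c \<in> groups N" "\<And>i. i \<in> links N \<Longrightarrow> 0 \<le> d i"
  shows "0 \<le> singleton_schedule d r c"
  using assms by (auto simp: singleton_schedule_def groups_def is_singleton_def)

lemma is_schedule_singleton_schedule:
  assumes "0 < r 1" "\<And>i. i \<in> links N \<Longrightarrow> 0 \<le> d i"
  shows "is_schedule N d r (singleton_schedule d r)"
  using assms service_singleton_schedule[of r _ N d] singleton_schedule_nonneg[of r _ N d]
  by (auto simp: is_schedule_def)

text \<open>This is the throughput of an active group, the quantity that the criterion compares with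
  \<open>r 1\<close>.\<close>

lemma sum_rate:
  assumes "c \<subseteq> links N"
  shows "(\<Sum>i\<in>links N. rate r c i) = real (card c) * r (card c)"
  unfolding rate_def using assms
  by (simp add: sum.If_cases Int_absorb1)

lemma sum_demands_eq:
  assumes "is_schedule N d r T"
  shows "(\<Sum>i\<in>links N. d i) = (\<Sum>c\<in>groups N. real (card c) * r (card c) * T c)"
proof -
  have "(\<Sum>i\<in>links N. d i) = (\<Sum>i\<in>links N. \<Sum>c\<in>groups N. rate r c i * T c)"
    using assms by (simp add: is_schedule_def)
  also have "\<dots> = (\<Sum>c\<in>groups N. (\<Sum>i\<in>links N. rate r c i) * T c)"
    by (subst sum.swap) (simp add: sum_distrib_right)
  also have "\<dots> = (\<Sum>c\<in>groups N. real (card c) * r (card c) * T c)"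
    by (intro sum.cong) (auto simp: sum_rate groups_def)
  finally show ?thesis .
qed

lemma card_group:
  assumes "c \<in> groups N"
  shows "card c \<in> {1..N}"
proof -
  have "c \<subseteq> {1..N}" "c \<noteq> {}"
    using assms by (auto simp: groups_def links_def)
  then show ?thesis
    using card_mono[of "{1..N}" c] finite_subset[of c "{1..N}"]
    by (simp add: Suc_le_eq card_gt_0_iff)
qed

lemma schedule_length_lower_bound:
  assumes "is_schedule N d r T" "0 < r 1" "\<And>m. m \<in> {2..N} \<Longrightarrow> real m * r m \<le> r 1"
  shows "(\<Sum>i\<in>links N. d i) / r 1 \<le> schedule_length N T"
proof -
  \<comment> \<open>Size 1 gives equality; every other size lies in \<open>{2..N}\<close>, where the
    assumption applies.\<close>
  have "real (card c) * r (card c) \<le> r 1" if "c \<in> groups N" for c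
    using card_group[OF that] assms(3)[of "card c"] by (cases "card c = 1") auto
  then have "(\<Sum>i\<in>links N. d i) \<le> (\<Sum>c\<in>groups N. r 1 * T c)"
    unfolding sum_demands_eq[OF assms(1)] using assms(1)
    by (intro sum_mono mult_right_mono) (auto simp: is_schedule_def)
  then show ?thesis
    using assms(2) by (simp add: schedule_length_def sum_distrib_left divide_le_eq mult.commute)
qed

text \<open>Adding \<open>e\<close> at \<open>C\<close>, rather than overwriting the value there,
  keeps the service right even when \<open>C\<close> is a singleton.\<close>

definition add_group ::
  "(nat \<Rightarrow> real) \<Rightarrow> (nat \<Rightarrow> real) \<Rightarrow> nat set \<Rightarrow> real \<Rightarrow> nat set \<Rightarrow> real" where
  "add_group d r C e c =
     singleton_schedule (\<lambda>i. d i - rate r C i * e) r c + (if c = C then e else 0)"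

lemma is_schedule_add_group:
  assumes "0 < r 1" "C \<in> groups N" "0 \<le> e" "\<And>i. i \<in> links N \<Longrightarrow> rate r C i * e \<le> d i"
  shows "is_schedule N d r (add_group d r C e)"
  unfolding is_schedule_def
proof (intro conjI ballI)
  fix c assume "c \<in> groups N"
  then show "0 \<le> add_group d r C e c"
    using assms by (auto simp: add_group_def intro!: add_nonneg_nonneg singleton_schedule_nonneg)
next
  fix i assume i: "i \<in> links N"
  \<comment> \<open>Service is linear in the schedule: the singletons deliver the residual demand of
    \<open>i\<close>, and \<open>C\<close> delivers the rest.\<close>
  have "(\<Sum>c\<in>groups N. rate r c i * add_group d r C e c) =
      (\<Sum>c\<in>groups N. rate r c i * singleton_schedule (\<lambda>i. d i - rate r C i * e) r c) +
      (\<Sum>c\<in>groups N. if c = C then rate r c i * e else 0)"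
    unfolding sum.distrib[symmetric]
    by (intro sum.cong) (auto simp: add_group_def distrib_left)
  also have "\<dots> = d i"
    using assms i by (simp add: service_singleton_schedule)
  finally show "(\<Sum>c\<in>groups N. rate r c i * add_group d r C e c) = d i" .
qed

text \<open>Time \<open>e\<close> is spent on \<open>C\<close>, and the demand
  \<open>real (card C) * r (card C) * e\<close> that it serves no longer takes singleton time at
  rate \<open>r 1\<close>.\<close>

lemma schedule_length_add_group:
  assumes "C \<in> groups N"
  shows "schedule_length N (add_group d r C e) =
    (\<Sum>i\<in>links N. d i) / r 1 + e * (1 - real (card C) * r (card C) / r 1)"
proof -
  have "C \<subseteq> links N"
    using assms by (simp add: groups_def)
  have "schedule_length N (add_group d r C e) =
      schedule_length N (singleton_schedule (\<lambda>i. d i - rate r C i * e) r) + e"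
    using assms by (simp add: schedule_length_def add_group_def sum.distrib)
  also have "\<dots> = ((\<Sum>i\<in>links N. d i) - (\<Sum>i\<in>links N. rate r C i) * e) / r 1 + e"
    unfolding schedule_length_singleton_schedule
    by (simp add: sum_subtractf sum_distrib_right)
  finally show ?thesis
    unfolding sum_rate[OF \<open>C \<subseteq> links N\<close>] by (simp add: diff_divide_distrib algebra_simps)
qed

theorem corollary6:
  fixes N :: nat and d r :: "nat \<Rightarrow> real"
  assumes "valid_instance N d r"
  shows "optimal_schedule N d r (singleton_schedule d r) \<longleftrightarrow>
    (\<forall>m\<in>{2..N}. real m * r m \<le> r 1)"
proof -
  have r1: "0 < r 1" and d: "\<And>i. i \<in> links N \<Longrightarrow> 0 < d i"
    using assms by (auto simp: valid_instance_def)
  have sched: "is_schedule N d r (singleton_schedule d r)"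
    using r1 d by (simp add: is_schedule_singleton_schedule less_imp_le)
  show ?thesis
  proof
    assume "\<forall>m\<in>{2..N}. real m * r m \<le> r 1"
    then show "optimal_schedule N d r (singleton_schedule d r)"
      unfolding optimal_schedule_def schedule_length_singleton_schedule
      using sched schedule_length_lower_bound[of N d r] r1
      by blast
  next
    assume opt: "optimal_schedule N d r (singleton_schedule d r)"
    show "\<forall>m\<in>{2..N}. real m * r m \<le> r 1"
    proof (intro ballI leI notI)
      fix m assume m: "m \<in> {2..N}" and gt: "r 1 < real m * r m"
      \<comment> \<open>The duration \<open>e\<close> chosen below is a quotient by
        \<open>r m\<close>, which therefore has to be positive.\<close>
      have "0 < real m * r m"
        using gt r1 by linarith
      then have rm: "0 < r m"
        by (simp add: zero_less_mult_iff)
      define C where "C = {1..m}"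
      have C: "C \<in> groups N" "card C = m"
        using m by (auto simp: C_def groups_def links_def)
      \<comment> \<open>In time \<open>e\<close> each member of \<open>C\<close> receives exactly
        the smallest demand of all links, so no residual demand becomes negative; \<open>e\<close>
        is positive as a minimum of finitely many positive demands over \<open>r m\<close>.\<close>
      define e where "e = Min (d ` links N) / r m"
      have ne: "links N \<noteq> {}"
        using m by (auto simp: links_def)
      have e: "0 < e"
        using d rm ne by (simp add: e_def)
      have "rate r C i * e \<le> d i" if "i \<in> links N" for i
        using that d[OF that] rm C by (simp add: rate_def e_def)
      then have "is_schedule N d r (add_group d r C e)"
        using is_schedule_add_group r1 C e by simp
      \<comment> \<open>The term \<open>(\<Sum>i\<in>links N. d i) / r 1\<close> is common to both
        lengths and cancels, leaving the change caused by \<open>C\<close>.\<close>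
      then have "0 \<le> e * (1 - real m * r m / r 1)"
        using opt C
        by (fastforce simp: optimal_schedule_def schedule_length_singleton_schedule
            schedule_length_add_group)
      moreover have "1 - real m * r m / r 1 < 0"
        using gt r1 by simp
      ultimately show False
        using e by (simp add: zero_le_mult_iff)
    qed
  qed
qed

end
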